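(* Let $\mathbf{A} \in \mathbb{R}^{n\times n}$ be symmetric positive semidefinite, let $\mathbf{M} = \mathbf{M}^\mathsf{T}$ be nonsingular with $\mathbf{A} = \mathbf{M}-\mathbf{N}$, let $\mathbf{H} = \mathbf{M}^{-1}\mathbf{N}$, let $\ell\ge 1$ be an integer, and let $\mathbf{C}^{(\ell)} = \sum_{i=0}^{\ell-1}\mathbf{H}^i\mathbf{M}^{-1}$ be symmetric positive definite. If $\mathbf{H}$ is semiconvergent, then the $k$th residual $\mathbf{r}_k = \mathbf{b} - \mathbf{A}\mathbf{x}_k$ of MINRES preconditioned by $\ell$ steps of the inner iterations, i.e., with preconditioning matrix $\mathbf{C}^{(\ell)}$, satisfies $$\|\check{\mathbf{r}}_k\|_2 \leq \min\left[\nu(\mathbf{H})^{k\ell},\ 2\left(\frac{\sqrt{\kappa^{(\ell)}}-1}{\sqrt{\kappa^{(\ell)}}+1}\right)^k\right]\|\check{\mathbf{r}}_0\|_2$$ for all $\mathbf{b}\in\mathcal{R}(\mathbf{A})$ and for all $\mathbf{x}_0\in\mathbb{R}^n$, where $\check{\mathbf{r}}_k = (\mathbf{C}^{(\ell)})^{\frac12}\mathbf{r}_k$.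
   Context: $\mathcal{R}(\cdot)$ denotes the range and $\sigma(\cdot)$ the spectrum. $\mathbf{H}$ is semiconvergent if $\lim_{i\to\infty}\mathbf{H}^i$ exists. The pseudo spectral radius is $\nu(\mathbf{H}) = \max\{|\lambda| : \lambda\in\sigma(\mathbf{H})\setminus\{1\}\}$. The number $\kappa^{(\ell)}$ is the condition number of the preconditioned matrix $\mathbf{C}^{(\ell)}\mathbf{A}$, namely the ratio of the largest to the smallest nonzero eigenvalue of $\mathbf{C}^{(\ell)}\mathbf{A}$ (these eigenvalues are real and nonnegative); equivalently $\kappa^{(\ell)} = \|\hat{\mathbf{A}}\|_2\|\hat{\mathbf{A}}^\dagger\|_2$ with $\hat{\mathbf{A}} = (\mathbf{C}^{(\ell)})^{\frac12}\mathbf{A}(\mathbf{C}^{(\ell)})^{\frac12}$ and $\dagger$ the pseudoinverse. In the trivial case $\mathbf{A}=\mathbf{0}$, where these quantities are void, all residuals are zero, and one sets $\nu(\mathbf{H})=0$, $\kappa^{(\ell)}=1$. MINRES preconditioned by $\mathbf{C}^{(\ell)}$: with $\mathbf{r}_0=\mathbf{b}-\mathbf{A}\mathbf{x}_0$, the $k$th iterate is the $\mathbf{x}_k\in\mathbf{x}_0+\mathcal{K}_k(\mathbf{C}^{(\ell)}\mathbf{A},\mathbf{C}^{(\ell)}\mathbf{r}_0)$ minimizing $\|(\mathbf{C}^{(\ell)})^{\frac12}(\mathbf{b}-\mathbf{A}\mathbf{x}_k)\|_2$, where $\mathcal{K}_k(\mathbf{B},\mathbf{v})=\mathrm{span}\{\mathbf{v},\mathbf{B}\mathbf{v},\dots,\mathbf{B}^{k-1}\mathbf{v}\}$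 (and $\mathcal{K}_0=\{\mathbf{0}\}$). *)

theory Defs
  imports "HOL-Analysis.Analysis"
begin

text \<open>
  The class instance of \<open>*\<close>, and hence of \<open>^\<close>, on \<open>'a ^ 'n ^ 'n\<close> is componentwise, so powers
  with respect to the matrix product \<open>**\<close> are defined here.
\<close>

primrec matpow :: "'a::semiring_1 ^ 'n ^ 'n \<Rightarrow> nat \<Rightarrow> 'a ^ 'n ^ 'n" where
  "matpow B 0 = mat 1"
| "matpow B (Suc i) = B ** matpow B i"

definition sym_psd :: "real ^ 'n ^ 'n \<Rightarrow> bool" where
  "sym_psd B \<longleftrightarrow> transpose B = B \<and> (\<forall>v. 0 \<le> v \<bullet> (B *v v))"

definition sym_pd :: "real ^ 'n ^ 'n \<Rightarrow> bool" where
  "sym_pd B \<longleftrightarrow> transpose B = B \<and> (\<forall>v. v \<noteq> 0 \<longrightarrow> 0 < v \<bullet> (B *v v))"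

text \<open>Meaningful for symmetric positive semidefinite \<open>B\<close>, where the root exists and is unique.\<close>

definition msqrt :: "real ^ 'n ^ 'n \<Rightarrow> real ^ 'n ^ 'n" where
  "msqrt B = (THE S. sym_psd S \<and> S ** S = B)"

text \<open>The spectrum of a real matrix consists of all its complex eigenvalues.\<close>

definition spectrum :: "real ^ 'n ^ 'n \<Rightarrow> complex set" where
  "spectrum B = {\<mu>. \<exists>v. v \<noteq> 0 \<and> map_matrix complex_of_real B *v v = \<mu> *s v}"

definition semiconvergent :: "real ^ 'n ^ 'n \<Rightarrow> bool" where
  "semiconvergent B \<longleftrightarrow> convergent (matpow B)"

text \<open>
  A semiconvergent \<open>H = M\<^sup>-\<^sup>1 N\<close> has no eigenvalue other than 1 exactly if \<open>H = I\<close>, that is, if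
  \<open>A = M - N = 0\<close>; the value is then 0 by convention.
\<close>

definition pseudo_spectral_radius :: "real ^ 'n ^ 'n \<Rightarrow> real" where
  "pseudo_spectral_radius B =
     (if spectrum B - {1} = {} then 0 else Max (cmod ` (spectrum B - {1})))"

definition real_eigenvalues :: "real ^ 'n ^ 'n \<Rightarrow> real set" where
  "real_eigenvalues B = {\<mu>. complex_of_real \<mu> \<in> spectrum B}"

text \<open>
  Ratio of the largest to the smallest nonzero eigenvalue, for matrices \<open>B = C A\<close> with \<open>C\<close>
  symmetric positive definite and \<open>A\<close> symmetric positive semidefinite.  All eigenvalues of such
  \<open>B\<close> are real and nonnegative, and they are all zero exactly if \<open>A = 0\<close>; the value is then 1
  by convention.
\<close>

definition spectral_cond :: "real ^ 'n ^ 'n \<Rightarrow> real" where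
  "spectral_cond B =
     (if real_eigenvalues B - {0} = {} then 1
      else Max (real_eigenvalues B) / Min (real_eigenvalues B - {0}))"

definition krylov :: "nat \<Rightarrow> real ^ 'n ^ 'n \<Rightarrow> real ^ 'n \<Rightarrow> (real ^ 'n) set" where
  "krylov k B v = span ((\<lambda>i. matpow B i *v v) ` {..<k})"

definition inner_precond :: "real ^ 'n ^ 'n \<Rightarrow> real ^ 'n ^ 'n \<Rightarrow> nat \<Rightarrow> real ^ 'n ^ 'n" where
  "inner_precond M H l = (\<Sum>i<l. matpow H i ** matrix_inv M)"

definition minres_iterate ::
  "real ^ 'n ^ 'n \<Rightarrow> real ^ 'n ^ 'n \<Rightarrow> real ^ 'n \<Rightarrow> real ^ 'n \<Rightarrow> nat \<Rightarrow> real ^ 'n \<Rightarrow> bool" where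
  "minres_iterate C A b x0 k x \<longleftrightarrow>
     is_arg_min (\<lambda>y. norm (msqrt C *v (b - A *v y)))
       (\<lambda>y. y \<in> (+) x0 ` krylov k (C ** A) (C *v (b - A *v x0))) x"

lemma minres_iterate_exists: "\<exists>x. minres_iterate C A b x0 k x"
proof -
  define K where "K = krylov k (C ** A) (C *v (b - A *v x0))"
  define T where "T = (\<lambda>y. (msqrt C ** A) *v y) ` K"
  define c where "c = msqrt C *v (b - A *v x0)"
  have "subspace T"
    unfolding T_def K_def krylov_def
    by (intro linear_subspace_image matrix_vector_mul_linear subspace_span)
  then have "closed T" "T \<noteq> {}"
    using subspace_0 by (auto simp: closed_subspace)
  then obtain t where t: "t \<in> T" "\<And>u. u \<in> T \<Longrightarrow> dist c t \<le> dist c u"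
    using distance_attains_inf by metis
  then obtain y where y: "y \<in> K" "t = (msqrt C ** A) *v y"
    by (auto simp: T_def)
  have eq: "norm (msqrt C *v (b - A *v (x0 + z))) = dist c ((msqrt C ** A) *v z)" for z
    by (simp add: c_def dist_norm matrix_vector_mult_diff_distrib matrix_vector_right_distrib
        matrix_vector_mul_assoc algebra_simps)
  have "minres_iterate C A b x0 k (x0 + y)"
    unfolding minres_iterate_def is_arg_min_linorder K_def[symmetric]
    using y t(2) by (auto simp: eq T_def)
  then show ?thesis ..
qed

end

theory Submission
  imports Defs "HOL-Computational_Algebra.Polynomial"
begin

text \<open>
  With \<open>S = C\<^sup>1\<^sup>/\<^sup>2\<close>, the matrix \<open>H C\<close> is symmetric, hence so is \<open>G = S\<^sup>-\<^sup>1 H S\<close>, and \<open>C A = I - H\<^sup>l\<close>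
  gives \<open>S A S = I - G\<^sup>l\<close>.  An orthonormal eigenbasis of \<open>G\<close> with eigenvalues \<open>\<mu>\<close> therefore
  diagonalises \<open>S A S\<close> with eigenvalues \<open>1 - \<mu>\<^sup>l\<close>.  MINRES minimises over the residual polynomials
  \<open>q\<close> of degree at most \<open>k\<close> with \<open>q(0) = 1\<close>, and \<open>S r\<^sub>0\<close> has no component in the kernel of \<open>S A S\<close>,
  so the residual is bounded by the maximum of \<open>|q|\<close> on the nonzero eigenvalues.  The polynomial
  \<open>(1 - X)\<^sup>k\<close> yields the first bound and a transplanted Chebyshev polynomial the second.
\<close>

section \<open>Spectral theorem and square roots of symmetric matrices\<close>

text \<open>A maximiser of the Rayleigh quotient on the unit sphere of \<open>V\<close> is an
  eigenvector: otherwise moving it along the defect of the eigenvalue equation would increase the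
  quotient.\<close>

lemma selfadjoint_invariant_eigenvector:
  fixes f :: "'a::euclidean_space \<Rightarrow> 'a"
  assumes "linear f" and sa: "\<And>x y. f x \<bullet> y = x \<bullet> f y"
    and V: "subspace V" "V \<noteq> {0}" "f ` V \<subseteq> V"
  obtains u \<mu> where "u \<in> V" "norm u = 1" "f u = \<mu> *\<^sub>R u"
proof -
  interpret f: linear f by fact
  define K where "K = V \<inter> sphere 0 1"
  obtain w where w: "w \<in> V" "w \<noteq> 0"
    using V subspace_0 by blast
  then have "(1 / norm w) *\<^sub>R w \<in> K"
    by (simp add: K_def V subspace_scale)
  then have "K \<noteq> {}" by auto
  moreover have "compact K"
    unfolding K_def using V(1) by (simp add: closed_subspace closed_Int_compact)
  moreover have "continuous_on K (\<lambda>x. x \<bullet> f x)"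
    by (intro continuous_intros linear_continuous_on \<open>linear f\<close>[THEN linear_linear[THEN iffD2]])
  ultimately obtain u where u: "u \<in> K" and max: "\<And>x. x \<in> K \<Longrightarrow> x \<bullet> f x \<le> u \<bullet> f u"
    using continuous_attains_sup by metis
  define \<mu> where "\<mu> = u \<bullet> f u"
  have uV: "u \<in> V" and nu: "norm u = 1" using u by (auto simp: K_def)
  have nonneg: "x \<bullet> f x \<le> \<mu> * (x \<bullet> x)" if "x \<in> V" for x
  proof (cases "x = 0")
    case False
    have "(1 / norm x) *\<^sub>R x \<in> K"
      using that False by (simp add: K_def V subspace_scale)
    from max[OF this] have "(x \<bullet> f x) / (norm x)\<^sup>2 \<le> \<mu>"
      by (simp add: f.scale \<mu>_def power2_eq_square)
    then show ?thesis
      using False by (simp add: divide_simps dot_square_norm)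
  qed simp
  \<comment> \<open>\<open>v\<close> is the defect of the eigenvalue equation. Comparing the
    maximiser with \<open>u + t *\<^sub>R v\<close> gives \<open>key\<close>: a linear term in
    \<open>t\<close> with slope \<open>2 * (v \<bullet> v)\<close> is dominated by a quadratic one,
    which fails for small positive \<open>t\<close> unless \<open>v = 0\<close>.\<close>
  define v where "v = f u - \<mu> *\<^sub>R u"
  have vV: "v \<in> V"
    unfolding v_def using V uV by (auto intro!: subspace_diff subspace_scale)
  have uu: "u \<bullet> u = 1" using nu by (simp add: dot_square_norm)
  have key: "2 * t * (v \<bullet> v) \<le> t\<^sup>2 * (\<mu> * (v \<bullet> v) - v \<bullet> f v)" for t
  proof -
    have vu: "v \<bullet> f u = v \<bullet> v + \<mu> * (v \<bullet> u)"
      by (simp add: v_def inner_diff_right inner_diff_left algebra_simps inner_commute)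
    have "(u + t *\<^sub>R v) \<bullet> f (u + t *\<^sub>R v) \<le> \<mu> * ((u + t *\<^sub>R v) \<bullet> (u + t *\<^sub>R v))"
      using V uV vV by (intro nonneg subspace_add subspace_scale)
    moreover have "(u + t *\<^sub>R v) \<bullet> f (u + t *\<^sub>R v) = \<mu> + 2 * t * (v \<bullet> f u) + t\<^sup>2 * (v \<bullet> f v)"
      using sa[of u v] by (simp add: f.add f.scale inner_add_left inner_add_right \<mu>_def
          inner_commute power2_eq_square algebra_simps)
    moreover have "(u + t *\<^sub>R v) \<bullet> (u + t *\<^sub>R v) = 1 + 2 * t * (v \<bullet> u) + t\<^sup>2 * (v \<bullet> v)"
      by (simp add: inner_add_left inner_add_right uu inner_commute power2_eq_square algebra_simps)
    ultimately have "\<mu> + 2 * t * (v \<bullet> f u) + t\<^sup>2 * (v \<bullet> f v) \<le> \<mu> * (1 + 2 * t * (v \<bullet> u) + t\<^sup>2 * (v \<bullet> v))"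
      by simp
    then show ?thesis unfolding vu by (simp add: algebra_simps)
  qed
  have "v \<bullet> v = 0"
  proof (rule ccontr)
    assume "v \<bullet> v \<noteq> 0"
    then have pos: "v \<bullet> v > 0" by simp
    \<comment> \<open>\<open>c\<close> is a positive bound for the quadratic coefficient in
      \<open>key\<close>, and \<open>t\<close> makes \<open>t\<^sup>2 * c\<close> equal to
      \<open>t * (v \<bullet> v)\<close>, half of the left-hand side.\<close>
    define c where "c = \<bar>\<mu> * (v \<bullet> v) - v \<bullet> f v\<bar> + 1"
    define t where "t = (v \<bullet> v) / c"
    have c: "c > 0" unfolding c_def by linarith
    have t: "t > 0" using pos c by (simp add: t_def)
    have "2 * t * (v \<bullet> v) \<le> t\<^sup>2 * c"
      using key[of t] by (rule order_trans) (intro mult_left_mono, auto simp: c_def)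
    also have "\<dots> = t * (v \<bullet> v)" using c by (simp add: t_def power2_eq_square)
    finally show False using t pos by simp
  qed
  then have "f u = \<mu> *\<^sub>R u" by (simp add: v_def)
  then show thesis using that uV nu by blast
qed

text \<open>Induction on the dimension: splitting off a unit eigenvector leaves its orthogonal
  complement in \<open>V\<close>, which \<open>f\<close> preserves by self-adjointness. Speaking of
  invariant subspaces makes the induction hypothesis applicable to that complement.\<close>

lemma selfadjoint_orthonormal_eigenbasis_subspace:
  fixes f :: "'a::euclidean_space \<Rightarrow> 'a"
  assumes f: "linear f" and sa: "\<And>x y. f x \<bullet> y = x \<bullet> f y"
    and V: "subspace V" "f ` V \<subseteq> V"
  shows "\<exists>B. pairwise orthogonal B \<and> (\<forall>b\<in>B. norm b = 1) \<and> span B = V \<and>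
    (\<forall>b\<in>B. \<exists>\<mu>. f b = \<mu> *\<^sub>R b)"
  using V
proof (induction "dim V" arbitrary: V rule: less_induct)
  case less
  interpret f: linear f by fact
  show ?case
  proof (cases "V = {0}")
    case True
    then show ?thesis by (intro exI[of _ "{}"]) auto
  next
    case False
    obtain u \<mu> where u: "u \<in> V" "norm u = 1" "f u = \<mu> *\<^sub>R u"
      using selfadjoint_invariant_eigenvector[OF f sa less.prems(1) False less.prems(2)] by blast
    define W where "W = V \<inter> {v. u \<bullet> v = 0}"
    have uu: "u \<bullet> u = 1" using u(2) by (simp add: dot_square_norm)
    have W: "subspace W"
      unfolding W_def by (intro subspace_inter less.prems subspace_hyperplane)
    have "f ` W \<subseteq> W"
      using less.prems(2) by (auto simp: W_def sa[of u, symmetric] u(3))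
    moreover have "dim W < dim V"
    proof (rule dim_psubset)
      have "u \<notin> W" "W \<subseteq> V" using uu by (auto simp: W_def)
      then have "W \<subset> V" using u(1) by blast
      then show "span W \<subset> span V"
        using W less.prems(1) by (metis span_eq_iff)
    qed
    ultimately obtain B where B: "pairwise orthogonal B" "\<forall>b\<in>B. norm b = 1" "span B = W"
      "\<forall>b\<in>B. \<exists>\<mu>. f b = \<mu> *\<^sub>R b"
      using less.hyps W by blast
    have orth: "u \<bullet> b = 0" if "b \<in> B" for b
      using that B(3) span_superset[of B] by (auto simp: W_def)
    have "span (insert u B) = V"
    proof
      show "span (insert u B) \<subseteq> V"
        using u(1) B(3) span_superset[of B] less.prems(1)
        by (intro span_minimal) (auto simp: W_def)
      show "V \<subseteq> span (insert u B)"
      proof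
        fix v assume "v \<in> V"
        then have "v - (u \<bullet> v) *\<^sub>R u \<in> W"
          using u(1) less.prems(1) uu
          by (auto simp: W_def inner_diff_right intro!: subspace_diff subspace_scale)
        then show "v \<in> span (insert u B)"
          unfolding span_breakdown_eq B(3) by blast
      qed
    qed
    moreover have "pairwise orthogonal (insert u B)"
      using B(1) orth by (auto simp: pairwise_insert orthogonal_def inner_commute)
    ultimately show ?thesis
      using B(2,4) u(2,3) by (intro exI[of _ "insert u B"]) auto
  qed
qed

lemma symmetric_orthonormal_eigenbasis:
  fixes B :: "real ^ 'n ^ 'n"
  assumes "transpose B = B"
  obtains U \<mu> where "finite U" "pairwise orthogonal U" "\<And>u. u \<in> U \<Longrightarrow> norm u = 1" "span U = UNIV"
    "\<And>u. u \<in> U \<Longrightarrow> B *v u = \<mu> u *\<^sub>R u"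
proof -
  have "(B *v x) \<bullet> y = x \<bullet> (B *v y)" for x y
    using assms by (metis dot_lmul_matrix vector_transpose_matrix)
  then obtain U where U: "pairwise orthogonal U" "\<forall>b\<in>U. norm b = 1" "span U = UNIV"
    "\<forall>b\<in>U. \<exists>\<mu>. B *v b = \<mu> *\<^sub>R b"
    using selfadjoint_orthonormal_eigenbasis_subspace[of "(*v) B" UNIV] by auto
  have "independent U"
    using U(1,2) by (intro pairwise_orthogonal_independent) auto
  then have "finite U" using independent_imp_finite by blast
  then show thesis using U that by metis
qed

text \<open>Parseval's identity; it reduces the comparison of residual norms to one of
  coordinates.\<close>

lemma norm_power2_orthonormal_basis:
  fixes v :: "'a::euclidean_space"
  assumes "finite U" "pairwise orthogonal U" "\<And>u. u \<in> U \<Longrightarrow> norm u = 1" "span U = UNIV"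
  shows "(norm v)\<^sup>2 = (\<Sum>u\<in>U. (u \<bullet> v)\<^sup>2)"
proof -
  have "(norm v)\<^sup>2 = v \<bullet> (\<Sum>u\<in>U. (v \<bullet> u) *\<^sub>R u)"
    using orthonormal_basis_expand[of U v] assms by (simp add: dot_square_norm)
  then show ?thesis
    by (simp add: inner_sum_right power2_eq_square inner_commute)
qed

lemma matrix_eqI_on_spanning:
  fixes P Q :: "real ^ 'n ^ 'm"
  assumes "span U = UNIV" "\<And>u. u \<in> U \<Longrightarrow> P *v u = Q *v u"
  shows "P = Q"
proof -
  have "P *v x = Q *v x" for x
    using linear_eq_on_span[of "(*v) P" "(*v) Q" U x] assms by auto
  then show ?thesis by (simp add: matrix_eq)
qed

text \<open>The root scales each vector of an orthonormal eigenbasis by the square root of its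
  eigenvalue; \<open>f\<close> is the corresponding sum of scaled rank-one projections.\<close>

lemma sym_psd_sqrt_exists:
  fixes B :: "real ^ 'n ^ 'n"
  assumes "sym_psd B"
  shows "\<exists>S. sym_psd S \<and> S ** S = B"
proof -
  obtain U \<mu> where U: "finite U" "pairwise orthogonal U" "\<And>u. u \<in> U \<Longrightarrow> norm u = 1" "span U = UNIV"
    and eig: "\<And>u. u \<in> U \<Longrightarrow> B *v u = \<mu> u *\<^sub>R u"
    using symmetric_orthonormal_eigenbasis assms unfolding sym_psd_def by metis
  have nonneg: "0 \<le> \<mu> u" if "u \<in> U" for u
    using assms eig[OF that] U(3)[OF that] by (auto simp: sym_psd_def dot_square_norm dest: spec[of _ u])
  define f where "f x = (\<Sum>u\<in>U. (sqrt (\<mu> u) * (u \<bullet> x)) *\<^sub>R u)" for x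
  have "linear f"
    unfolding f_def
    by (intro linearI) (simp_all add: inner_add_right algebra_simps sum.distrib scaleR_sum_right)
  define S where "S = matrix f"
  have S: "S *v x = f x" for x
    unfolding S_def using \<open>linear f\<close> by (simp add: matrix_works)
  have feig: "f u = sqrt (\<mu> u) *\<^sub>R u" if "u \<in> U" for u
  proof -
    have "f u = (\<Sum>w\<in>U. if w = u then sqrt (\<mu> u) *\<^sub>R u else 0)"
      unfolding f_def using U(2,3) that
      by (intro sum.cong refl) (auto simp: pairwise_def orthogonal_def dot_square_norm)
    then show ?thesis using U(1) that by simp
  qed
  have "S ** S = B"
  proof (rule matrix_eqI_on_spanning[OF U(4)])
    fix u assume u: "u \<in> U"
    then show "(S ** S) *v u = B *v u"
      by (simp add: matrix_vector_mul_assoc[symmetric] S feig eig linear_scale[OF \<open>linear f\<close>] nonneg)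
  qed
  moreover have "sym_psd S"
    unfolding sym_psd_def
  proof (intro conjI allI)
    have "x \<bullet> f y = f x \<bullet> y" for x y
      by (simp add: f_def inner_sum_left inner_sum_right inner_commute mult.commute mult.left_commute)
    then show "transpose S = S"
      by (metis (no_types) S adjoint_matrix adjoint_unique matrix_eq)
    show "0 \<le> v \<bullet> (S *v v)" for v
      unfolding S f_def inner_sum_right
      by (intro sum_nonneg) (simp add: nonneg inner_commute mult.assoc)
  qed
  ultimately show ?thesis by blast
qed

text \<open>If \<open>S *v u = s *\<^sub>R u\<close>, then (T + s)(T - s)u = 0, so w = (T - s)u
  satisfies T w = -s w. Semidefiniteness of \<open>T\<close> forces w = 0 when s > 0; when s = 0,
  the squared norm of T u is u . T(T u) = 0.\<close>

lemma sym_psd_sqrt_unique: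
  fixes S T :: "real ^ 'n ^ 'n"
  assumes S: "sym_psd S" and T: "sym_psd T" and eq: "S ** S = T ** T"
  shows "S = T"
proof -
  obtain U \<mu> where U: "finite U" "\<And>u. u \<in> U \<Longrightarrow> norm u = 1" "span U = UNIV"
    and eig: "\<And>u. u \<in> U \<Longrightarrow> S *v u = \<mu> u *\<^sub>R u"
    using symmetric_orthonormal_eigenbasis S unfolding sym_psd_def by metis
  show ?thesis
  proof (rule matrix_eqI_on_spanning[OF U(3)])
    fix u assume u: "u \<in> U"
    define s where "s = \<mu> u"
    have s: "0 \<le> s"
      using S eig[OF u] U(2)[OF u]
      by (auto simp: sym_psd_def dot_square_norm s_def dest: spec[of _ u])
    have TT: "T *v (T *v u) = (s * s) *\<^sub>R u"
      using eig[OF u] eq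
      by (metis s_def matrix_vector_mul_assoc matrix_vector_mult_scaleR scaleR_scaleR)
    define w where "w = T *v u - s *\<^sub>R u"
    have "T *v w = - s *\<^sub>R w"
      by (simp add: w_def matrix_vector_mult_diff_distrib TT matrix_vector_mult_scaleR algebra_simps)
    then have "0 \<le> - s * (w \<bullet> w)"
      using T by (metis sym_psd_def inner_scaleR_right)
    then have "w = 0 \<or> s = 0"
      using s by (metis inner_ge_zero inner_eq_zero_iff mult_minus_left neg_0_le_iff_le
          mult_nonneg_nonneg order_antisym mult_eq_0_iff)
    moreover have "w = 0" if "s = 0"
    proof -
      have "(T *v u) \<bullet> (T *v u) = u \<bullet> (T *v (T *v u))"
        using T by (metis sym_psd_def dot_lmul_matrix vector_transpose_matrix)
      then show ?thesis using TT that by (simp add: w_def)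
    qed
    ultimately show "S *v u = T *v u"
      using eig[OF u] by (auto simp: w_def s_def)
  qed
qed

lemma msqrt_sym_psd:
  assumes "sym_psd B"
  shows "sym_psd (msqrt B)" and "msqrt B ** msqrt B = B"
proof -
  have "\<exists>!S. sym_psd S \<and> S ** S = B"
    using sym_psd_sqrt_exists[OF assms] sym_psd_sqrt_unique by metis
  from theI'[OF this] show "sym_psd (msqrt B)" and "msqrt B ** msqrt B = B"
    unfolding msqrt_def by auto
qed

section \<open>Matrix powers and spectra\<close>

lemma matpow_commute: "matpow B i ** B = B ** matpow B i"
  by (induction i) (simp_all add: matrix_mul_assoc[symmetric])

lemma matpow_eigenvector:
  fixes B :: "real ^ 'n ^ 'n"
  assumes "B *v v = \<mu> *\<^sub>R v"
  shows "matpow B i *v v = \<mu> ^ i *\<^sub>R v"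
  by (induction i)
     (simp_all add: matrix_vector_mul_assoc[symmetric] matrix_vector_mult_scaleR assms mult.commute)

lemma real_eigenvector_in_spectrum:
  assumes "B *v v = \<mu> *\<^sub>R v" "v \<noteq> 0"
  shows "complex_of_real \<mu> \<in> spectrum B"
proof -
  define w where "w = (\<chi> i. complex_of_real (v $ i))"
  have "w \<noteq> 0" using assms(2) by (simp add: w_def vec_eq_iff)
  moreover have "(map_matrix complex_of_real B *v w) $ i = (complex_of_real \<mu> *s w) $ i" for i
    using arg_cong[where f = "\<lambda>x. complex_of_real (x $ i)", OF assms(1)]
    by (simp add: w_def matrix_vector_mult_def map_matrix_def)
  ultimately show ?thesis unfolding spectrum_def vec_eq_iff by blast
qed

text \<open>Pairing an eigenvector x + iy for \<mu> with a real left eigenvector \<open>t i\<close>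
  gives e i * z = \<mu> * z, where z is the complex number with parts \<open>t i \<bullet> x\<close>
  and \<open>t i \<bullet> y\<close>. Since the left eigenvectors span, some z is nonzero, and then
  \<mu> = e i.\<close>

lemma spectrum_subset_left_eigenvalues:
  assumes left: "\<And>i x. i \<in> I \<Longrightarrow> t i \<bullet> (B *v x) = e i * (t i \<bullet> x)" and T: "span (t ` I) = UNIV"
  shows "spectrum B \<subseteq> complex_of_real ` e ` I"
proof
  fix \<mu> assume "\<mu> \<in> spectrum B"
  then obtain w where w: "w \<noteq> 0" "map_matrix complex_of_real B *v w = \<mu> *s w"
    by (auto simp: spectrum_def)
  define x where "x = (\<chi> i. Re (w $ i))"
  define y where "y = (\<chi> i. Im (w $ i))"
  have eq: "(\<Sum>j\<in>UNIV. complex_of_real (B $ i $ j) * w $ j) = \<mu> * w $ i" for i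
    using arg_cong[where f = "\<lambda>x. x $ i", OF w(2)]
    by (simp add: matrix_vector_mult_def map_matrix_def)
  have Bx: "B *v x = Re \<mu> *\<^sub>R x - Im \<mu> *\<^sub>R y" and By: "B *v y = Re \<mu> *\<^sub>R y + Im \<mu> *\<^sub>R x"
    using arg_cong[where f = Re, OF eq] arg_cong[where f = Im, OF eq]
    by (simp_all add: vec_eq_iff x_def y_def matrix_vector_mult_def)
  have "\<exists>i\<in>I. t i \<bullet> x \<noteq> 0 \<or> t i \<bullet> y \<noteq> 0"
  proof (rule ccontr)
    assume "\<not> ?thesis"
    then have "x = 0" "y = 0"
      using T vector_eq_dot_span[of x "t ` I" 0] vector_eq_dot_span[of y "t ` I" 0] by auto
    then have "w = 0" by (simp add: x_def y_def vec_eq_iff complex_eq_iff)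
    with w(1) show False ..
  qed
  then obtain i where i: "i \<in> I" "Complex (t i \<bullet> x) (t i \<bullet> y) \<noteq> 0"
    by (auto simp: complex_eq_iff)
  have "complex_of_real (e i) * Complex (t i \<bullet> x) (t i \<bullet> y) = \<mu> * Complex (t i \<bullet> x) (t i \<bullet> y)"
    using left[OF i(1), of x] left[OF i(1), of y]
    by (simp add: Bx By complex_eq_iff inner_diff_right inner_add_right)
  then have "\<mu> = complex_of_real (e i)"
    using i(2) by simp
  then show "\<mu> \<in> complex_of_real ` e ` I" using i(1) by blast
qed

text \<open>
  Here \<open>B\<close> is similar to the symmetric matrix \<open>G\<close>; the rows \<open>transpose P *v u\<close> are left
  eigenvectors, which rules out any further complex eigenvalue.
\<close>

lemma spectrum_symmetrizable:
  fixes B P Q G :: "real ^ 'n ^ 'n"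
  assumes PQ: "P ** Q = mat 1" and BQ: "B ** Q = Q ** G" and G: "transpose G = G"
    and U: "span U = UNIV" "0 \<notin> U" and eig: "\<And>u. u \<in> U \<Longrightarrow> G *v u = \<mu> u *\<^sub>R u"
  shows "spectrum B = complex_of_real ` \<mu> ` U"
proof
  have QP: "Q ** P = mat 1" using PQ matrix_left_right_inverse[of P Q] by blast
  \<comment> \<open>Multiplying \<open>B ** Q = Q ** G\<close> by \<open>P\<close> on both sides
    gives the intertwining relation needed for left eigenvectors.\<close>
  have "P ** B = P ** (B ** Q) ** P"
    using QP by (simp add: matrix_mul_assoc[symmetric])
  also have "\<dots> = P ** Q ** G ** P"
    by (simp add: BQ matrix_mul_assoc)
  finally have PB: "P ** B = G ** P"
    by (simp add: PQ)
  show "spectrum B \<subseteq> complex_of_real ` \<mu> ` U"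
  proof (rule spectrum_subset_left_eigenvalues)
    fix u x assume u: "u \<in> U"
    have adj: "(transpose P *v u) \<bullet> y = u \<bullet> (P *v y)" for y
      by (metis dot_lmul_matrix transpose_matrix_vector)
    have "u \<bullet> (G *v y) = \<mu> u * (u \<bullet> y)" for y
      using eig[OF u] G by (metis dot_lmul_matrix transpose_matrix_vector inner_scaleR_left)
    then show "(transpose P *v u) \<bullet> (B *v x) = \<mu> u * ((transpose P *v u) \<bullet> x)"
      unfolding adj using PB by (metis matrix_vector_mul_assoc)
  next
    have "transpose P ** transpose Q = mat 1"
      by (metis QP matrix_transpose_mul transpose_mat)
    then have "surj ((*v) (transpose P))"
      by (metis surjI matrix_vector_mul_assoc matrix_vector_mul_lid)
    then show "span ((*v) (transpose P) ` U) = UNIV"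
      using U(1) linear_span_image[OF matrix_vector_mul_linear[of "transpose P"], of U] by metis
  qed
  show "complex_of_real ` \<mu> ` U \<subseteq> spectrum B"
  proof clarify
    fix u assume u: "u \<in> U"
    have "Q *v u \<noteq> 0"
      using U(2) u PQ by (metis matrix_vector_mul_assoc matrix_vector_mul_lid matrix_vector_mult_0_right)
    moreover have "B *v (Q *v u) = \<mu> u *\<^sub>R (Q *v u)"
      using BQ eig[OF u] by (metis matrix_vector_mul_assoc matrix_vector_mult_scaleR)
    ultimately show "complex_of_real (\<mu> u) \<in> spectrum B"
      by (rule real_eigenvector_in_spectrum[rotated])
  qed
qed

section \<open>Chebyshev polynomials\<close>

fun chebyshev_poly :: "nat \<Rightarrow> real poly" where
  "chebyshev_poly 0 = 1"
| "chebyshev_poly (Suc 0) = [:0, 1:]"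
| "chebyshev_poly (Suc (Suc k)) = [:0, 2:] * chebyshev_poly (Suc k) - chebyshev_poly k"

lemma degree_chebyshev_poly_le: "degree (chebyshev_poly k) \<le> k"
proof (induction k rule: chebyshev_poly.induct)
  case (3 k)
  have "degree ([:0, 2:] * chebyshev_poly (Suc k)) \<le> Suc (Suc k)"
    by (rule order_trans[OF degree_mult_le]) (use 3 in simp)
  then show ?case
    unfolding chebyshev_poly.simps using 3 by (intro degree_diff_le) auto
qed simp_all

lemma poly_chebyshev_cos: "poly (chebyshev_poly k) (cos t) = cos (real k * t)"
proof (induction k rule: chebyshev_poly.induct)
  case (3 k)
  have "cos (real (Suc (Suc k)) * t) + cos (real k * t) = 2 * cos t * cos (real (Suc k) * t)"
    using cos_times_cos[of t "real (Suc k) * t"]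
    by (simp add: algebra_simps cos_add cos_diff)
  with 3 show ?case by simp
qed simp_all

lemma abs_poly_chebyshev_le_1:
  assumes "\<bar>x\<bar> \<le> 1"
  shows "\<bar>poly (chebyshev_poly k) x\<bar> \<le> 1"
  using poly_chebyshev_cos[of k "arccos x"] assms by (simp add: cos_arccos_abs)

text \<open>The cosine identity with exp(it) replaced by a nonzero real \<open>y\<close>; it
  evaluates the polynomials outside the open interval (-1, 1), where they grow.\<close>

lemma poly_chebyshev_joukowski:
  assumes "y \<noteq> 0"
  shows "poly (chebyshev_poly k) ((y + 1 / y) / 2) = (y ^ k + 1 / y ^ k) / 2"
proof (induction k rule: chebyshev_poly.induct)
  case (3 k)
  have "poly (chebyshev_poly (Suc (Suc k))) ((y + 1 / y) / 2) =
      (y + 1 / y) * ((y ^ Suc k + 1 / y ^ Suc k) / 2) - (y ^ k + 1 / y ^ k) / 2"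
    unfolding 3[symmetric] by simp
  also have "\<dots> = (y ^ Suc (Suc k) + 1 / y ^ Suc (Suc k)) / 2"
    using assms by (simp add: field_simps)
  finally show ?case .
qed simp_all

text \<open>
  The Chebyshev polynomial transplanted to \<open>[a, b]\<close> and normalised at 0; the point 0 is mapped to
  \<open>(y + 1/y)/2\<close> for \<open>y = (sqrt (b/a) + 1) / (sqrt (b/a) - 1)\<close>.
\<close>

lemma chebyshev_residual_poly:
  fixes a b :: real
  assumes "0 < a" "a \<le> b"
  obtains q where "degree q \<le> k" "poly q 0 = 1"
    "\<And>x. a \<le> x \<Longrightarrow> x \<le> b \<Longrightarrow> \<bar>poly q x\<bar> \<le> 2 * ((sqrt (b / a) - 1) / (sqrt (b / a) + 1)) ^ k"
proof (cases "a = b")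
  case True
  \<comment> \<open>The affine map onto [-1, 1] degenerates here. A linear factor vanishing at the
    single point \<open>a\<close> suffices: for k > 0 both sides are 0, and for k = 0 the bound is
    2.\<close>
  define q where "q = [:1, - 1 / a:] ^ k"
  have "degree q \<le> k" using degree_power_le[of "[:1, - 1 / a:]" k] assms by (simp add: q_def)
  moreover have "poly q 0 = 1" by (simp add: q_def)
  moreover have "\<bar>poly q x\<bar> \<le> 2 * ((sqrt (b / a) - 1) / (sqrt (b / a) + 1)) ^ k"
    if "a \<le> x" "x \<le> b" for x
    using that True assms by (cases k) (auto simp: q_def)
  ultimately show thesis using that by blast
next
  case False
  then have ab: "0 < a" "a < b" using assms by auto
  define s where "s = sqrt (b / a)"
  have s: "1 < s" using ab by (simp add: s_def)
  have b: "b = s\<^sup>2 * a" using ab by (simp add: s_def)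
  define y where "y = (s + 1) / (s - 1)"
  have y: "0 < y" using s by (simp add: y_def)
  define T where "T = chebyshev_poly k \<circ>\<^sub>p [:(b + a) / (b - a), - 2 / (b - a):]"
  define c where "c = (y ^ k + 1 / y ^ k) / 2"
  \<comment> \<open>Dropping \<open>1 / y ^ k\<close> from \<open>c\<close> produces the factor 2 of
    the final bound.\<close>
  have c: "y ^ k / 2 < c" "0 < c" using y by (simp_all add: c_def add_pos_pos)
  have "(b + a) / (b - a) = (s\<^sup>2 + 1) / (s\<^sup>2 - 1)"
  proof -
    have "b + a = (s\<^sup>2 + 1) * a" "b - a = (s\<^sup>2 - 1) * a" by (simp_all add: b algebra_simps)
    then show ?thesis using ab by simp
  qed
  also have "\<dots> = (y + 1 / y) / 2"
  proof -
    have "s\<^sup>2 - 1 = (s + 1) * (s - 1)" by (simp add: power2_eq_square algebra_simps)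
    then show ?thesis using s by (simp add: y_def divide_simps) (simp add: power2_eq_square algebra_simps)
  qed
  finally have mid: "(b + a) / (b - a) = (y + 1 / y) / 2" .
  have "poly T 0 = poly (chebyshev_poly k) ((y + 1 / y) / 2)"
    unfolding mid[symmetric] by (simp add: T_def poly_pcompose)
  then have T0: "poly T 0 = c"
    using poly_chebyshev_joukowski[of y k] y by (simp add: c_def)
  have Tle: "\<bar>poly T x\<bar> \<le> 1" if "a \<le> x" "x \<le> b" for x
  proof -
    have "(b + a) / (b - a) + x * (- 2 / (b - a)) = (b + a - 2 * x) / (b - a)"
      by (simp add: diff_divide_distrib)
    moreover have "\<bar>(b + a - 2 * x) / (b - a)\<bar> \<le> 1"
      using that ab by (simp add: abs_le_iff divide_simps)
    ultimately show ?thesis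
      unfolding T_def poly_pcompose by (intro abs_poly_chebyshev_le_1) simp
  qed
  define q where "q = smult (1 / c) T"
  have "degree T \<le> k"
    unfolding T_def degree_pcompose using degree_chebyshev_poly_le[of k] ab by simp
  then have "degree q \<le> k" using degree_smult_le order_trans by (metis q_def)
  moreover have "poly q 0 = 1" using T0 c by (simp add: q_def)
  moreover have "\<bar>poly q x\<bar> \<le> 2 * ((s - 1) / (s + 1)) ^ k" if "a \<le> x" "x \<le> b" for x
  proof -
    have "\<bar>poly q x\<bar> \<le> 1 / c"
      using Tle[OF that] c by (simp add: q_def abs_mult divide_simps)
    also have "\<dots> \<le> 1 / (y ^ k / 2)"
      using c y by (intro divide_left_mono) auto
    also have "\<dots> = 2 * ((s - 1) / (s + 1)) ^ k"
      by (simp add: y_def power_divide)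
    finally show ?thesis .
  qed
  ultimately show thesis using that unfolding s_def by blast
qed

section \<open>The preconditioner of the inner iterations\<close>

lemma matrix_inv_inverse:
  assumes "invertible M"
  shows "M ** matrix_inv M = mat 1" and "matrix_inv M ** M = mat 1"
proof -
  have "M ** matrix_inv M = mat 1 \<and> matrix_inv M ** M = mat 1"
    using assms unfolding invertible_def matrix_inv_def by (rule someI_ex)
  then show "M ** matrix_inv M = mat 1" and "matrix_inv M ** M = mat 1" by auto
qed

lemma transpose_matrix_inv:
  fixes M :: "real ^ 'n ^ 'n"
  assumes "invertible M" "transpose M = M"
  shows "transpose (matrix_inv M) = matrix_inv M"
proof -
  have "transpose (matrix_inv M) ** M = mat 1"
    using arg_cong[OF matrix_inv_inverse(1)[OF assms(1)], of transpose] assms(2)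
    by (simp add: matrix_transpose_mul)
  then show ?thesis
    using matrix_inv_inverse(1)[OF assms(1)] by (metis matrix_mul_assoc matrix_mul_lid matrix_mul_rid)
qed

lemma matrix_diff_ldistrib:
  fixes A :: "'a::ring_1 ^ 'n ^ 'm"
  shows "A ** (B - C) = A ** B - A ** C"
  by (simp add: vec_eq_iff matrix_matrix_mult_def algebra_simps sum_subtractf)

lemma matrix_add_rdistrib:
  fixes A :: "'a::semiring_1 ^ 'n ^ 'm"
  shows "(B + C) ** A = B ** A + C ** A"
  by (simp add: vec_eq_iff matrix_matrix_mult_def algebra_simps sum.distrib)

lemma transpose_add:
  "transpose (A + B) = transpose A + transpose B"
  by (simp add: transpose_def vec_eq_iff)

text \<open>The matrix is the alternating product P N P ... N P of symmetric factors. This word is a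
  palindrome, and transposition only reverses it.\<close>

lemma transpose_matpow_mult:
  fixes P N :: "real ^ 'n ^ 'n"
  assumes "transpose P = P" "transpose N = N"
  shows "transpose (matpow (P ** N) i ** P) = matpow (P ** N) i ** P"
proof (induction i)
  case (Suc i)
  have "transpose (matpow (P ** N) (Suc i) ** P) = transpose (P ** N ** (matpow (P ** N) i ** P))"
    by (simp add: matrix_mul_assoc)
  also have "\<dots> = matpow (P ** N) i ** P ** (N ** P)"
    unfolding matrix_transpose_mul[of "P ** N"] Suc by (simp add: matrix_transpose_mul assms)
  also have "\<dots> = matpow (P ** N) i ** (P ** N) ** P"
    by (simp add: matrix_mul_assoc)
  finally show ?case by (simp add: matpow_commute)
qed (simp add: assms)

lemma inner_precond_Suc:
  "inner_precond M H (Suc l) = inner_precond M H l + matpow H l ** matrix_inv M"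
  by (simp add: inner_precond_def add.commute)

text \<open>Each summand is \<open>matpow H (Suc i) ** matrix_inv M\<close>, again a palindrome in
  the symmetric factors \<open>matrix_inv M\<close> and \<open>N\<close>.\<close>

lemma transpose_iteration_inner_precond:
  fixes M N :: "real ^ 'n ^ 'n"
  assumes "invertible M" "transpose M = M" "transpose N = N" and H: "H = matrix_inv M ** N"
  shows "transpose (H ** inner_precond M H l) = H ** inner_precond M H l"
proof (induction l)
  case 0
  show ?case by (simp add: inner_precond_def transpose_def vec_eq_iff)
next
  case (Suc l)
  have "transpose (H ** (matpow H l ** matrix_inv M)) = H ** (matpow H l ** matrix_inv M)"
    using transpose_matpow_mult[OF transpose_matrix_inv[OF assms(1,2)] assms(3), of "Suc l"]
    by (simp add: H matrix_mul_assoc)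
  with Suc show ?case
    by (simp add: inner_precond_Suc matrix_add_ldistrib transpose_add)
qed

text \<open>Telescoping: the summand with index i, multiplied by \<open>A\<close>, is
  \<open>matpow H i - matpow H (Suc i)\<close>.\<close>

lemma inner_precond_mult:
  fixes M A :: "real ^ 'n ^ 'n"
  assumes "matrix_inv M ** A = mat 1 - H"
  shows "inner_precond M H l ** A = mat 1 - matpow H l"
proof (induction l)
  case (Suc l)
  have "matpow H l ** matrix_inv M ** A = matpow H l - matpow H (Suc l)"
    by (simp add: matrix_mul_assoc[symmetric] assms matrix_diff_ldistrib matpow_commute)
  with Suc show ?case
    by (simp add: inner_precond_Suc matrix_add_rdistrib)
qed (simp add: inner_precond_def)

text \<open>The version of \<open>matpow_eigenvector\<close> for left eigenfunctionals, applied
  below to x \<mapsto> u . S A x and the matrix \<open>C ** A\<close>.\<close>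

lemma matpow_functional_eigenvalue:
  fixes B :: "real ^ 'n ^ 'n"
  assumes "\<And>x. g (B *v x) = e * g x"
  shows "g (matpow B i *v x) = e ^ i * (g x :: real)"
  by (induction i) (simp_all add: matrix_vector_mul_assoc[symmetric] assms)

section \<open>Residual bounds\<close>

text \<open>Every admissible \<open>q\<close> is the residual polynomial of some competitor
  \<open>y\<close> in the Krylov space, and the minimiser does at least as well. Leaving
  \<open>q\<close> arbitrary makes both bounds of the theorem instances.\<close>

lemma minres_residual_le:
  fixes A C :: "real ^ 'n ^ 'n"
  defines "S \<equiv> msqrt C"
  assumes A: "transpose A = A" and C: "sym_pd C"
    and U: "finite U" "pairwise orthogonal U" "\<And>u. u \<in> U \<Longrightarrow> norm u = 1" "span U = UNIV"
    and eig: "\<And>u. u \<in> U \<Longrightarrow> (S ** A ** S) *v u = \<theta> u *\<^sub>R u"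
    and b: "b \<in> range ((*v) A)" and xk: "minres_iterate C A b x0 k xk"
    and q: "degree q \<le> k" "poly q 0 = 1"
    and \<epsilon>: "0 \<le> \<epsilon>" "\<And>u. u \<in> U \<Longrightarrow> \<theta> u \<noteq> 0 \<Longrightarrow> \<bar>poly q (\<theta> u)\<bar> \<le> \<epsilon>"
  shows "norm (S *v (b - A *v xk)) \<le> \<epsilon> * norm (S *v (b - A *v x0))"
proof -
  have "sym_psd C"
    using C unfolding sym_pd_def sym_psd_def by (metis inner_zero_left less_imp_le order_refl)
  then have S: "sym_psd S" "S ** S = C" unfolding S_def by (rule msqrt_sym_psd)+
  have Sadj: "x \<bullet> (S *v y) = (S *v x) \<bullet> y" and Aadj: "x \<bullet> (A *v y) = (A *v x) \<bullet> y" for x y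
    using S(1) A unfolding sym_psd_def by (metis dot_lmul_matrix transpose_matrix_vector)+
  have Sinj: "x = 0" if "S *v x = 0" for x
    using that S(2) C unfolding sym_pd_def
    by (metis inner_zero_right less_irrefl matrix_vector_mul_assoc matrix_vector_mult_0_right)
  define r0 where "r0 = b - A *v x0"
  \<comment> \<open>Writing q = 1 + X p, the coefficients of p are \<open>coeff q (Suc i)\<close>,
    and y = x0 - p(CA) C r0. Its residual is r0 + A p(CA) C r0 = q(AC) r0.\<close>
  define y where "y = x0 + (\<Sum>i<k. - coeff q (Suc i) *\<^sub>R (matpow (C ** A) i *v (C *v r0)))"
  have "y \<in> (+) x0 ` krylov k (C ** A) (C *v r0)"
    unfolding y_def krylov_def
    by (intro imageI span_sum span_scale span_base) simp
  then have "norm (S *v (b - A *v xk)) \<le> norm (S *v (b - A *v y))"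
    using xk unfolding minres_iterate_def is_arg_min_linorder S_def r0_def by blast
  also have "\<dots> \<le> \<epsilon> * norm (S *v r0)"
  proof (rule power2_le_imp_le)
    have coord: "u \<bullet> (S *v (b - A *v y)) = poly q (\<theta> u) * (u \<bullet> (S *v r0))" if u: "u \<in> U" for u
    proof -
      define g where "g x = u \<bullet> (S *v (A *v x))" for x
      have g: "g (C *v x) = \<theta> u * (u \<bullet> (S *v x))" for x
      proof -
        have "g (C *v x) = ((S ** A ** S) *v u) \<bullet> (S *v x)"
          unfolding g_def S(2)[symmetric]
          by (simp add: Sadj Aadj matrix_vector_mul_assoc[symmetric])
        then show ?thesis by (simp add: eig[OF u])
      qed
      \<comment> \<open>The \<open>i\<close> factors \<open>C ** A\<close> and the last
        \<open>C\<close> contribute one factor \<open>\<theta> u\<close> each, hence the exponent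
        \<open>Suc i\<close>.\<close>
      have gi: "g (matpow (C ** A) i *v (C *v r0)) = \<theta> u ^ Suc i * (u \<bullet> (S *v r0))" for i
        using matpow_functional_eigenvalue[of g "C ** A" "\<theta> u" i "C *v r0"] g[of r0]
        by (simp add: g[unfolded g_def] g_def matrix_vector_mul_assoc[symmetric])
      have "linear g"
        unfolding g_def
        by (intro linearI) (simp_all add: matrix_vector_right_distrib matrix_vector_mult_scaleR inner_add_right)
      have "u \<bullet> (S *v (b - A *v y)) = u \<bullet> (S *v r0) - g (y - x0)"
        by (simp add: g_def r0_def matrix_vector_mult_diff_distrib inner_diff_right)
      also have "g (y - x0) = (\<Sum>i<k. - coeff q (Suc i) * (\<theta> u ^ Suc i * (u \<bullet> (S *v r0))))"
        unfolding y_def by (simp add: linear_sum[OF \<open>linear g\<close>] linear_scale[OF \<open>linear g\<close>]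
            linear_neg[OF \<open>linear g\<close>] gi del: power_Suc)
      also have "u \<bullet> (S *v r0) - \<dots> = (1 + (\<Sum>i<k. coeff q (Suc i) * \<theta> u ^ Suc i)) * (u \<bullet> (S *v r0))"
        by (simp add: sum_negf sum_distrib_right sum_distrib_left algebra_simps del: power_Suc)
      \<comment> \<open>The normalisation q(0) = 1 supplies the missing constant
        coefficient.\<close>
      also have "1 + (\<Sum>i<k. coeff q (Suc i) * \<theta> u ^ Suc i) = (\<Sum>i\<le>k. coeff q i * \<theta> u ^ i)"
        using q(2) by (simp add: lessThan_Suc_atMost[symmetric] sum.lessThan_Suc_shift poly_0_coeff_0 del: sum.lessThan_Suc)
      also have "\<dots> = poly q (\<theta> u)"
        unfolding poly_altdef using q(1)
        by (intro sum.mono_neutral_right) (auto simp: coeff_eq_0)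
      finally show ?thesis .
    qed
    have le: "(u \<bullet> (S *v (b - A *v y)))\<^sup>2 \<le> \<epsilon>\<^sup>2 * (u \<bullet> (S *v r0))\<^sup>2" if u: "u \<in> U" for u
    proof (cases "\<theta> u = 0")
      case True
      obtain z where z: "b = A *v z" using b by blast
      \<comment> \<open>Consistency of the system enters here: \<open>r0\<close> is A(z - x0), so
        its pairing with \<open>S *v u\<close> vanishes once
        \<open>A *v (S *v u) = 0\<close>.\<close>
      have "S *v (A *v (S *v u)) = 0"
        using eig[OF u] True by (simp add: matrix_vector_mul_assoc matrix_mul_assoc)
      then have "A *v (S *v u) = 0" by (rule Sinj)
      then have "u \<bullet> (S *v r0) = 0"
        unfolding r0_def z by (simp add: Sadj Aadj inner_diff_right)
      then show ?thesis by (simp add: coord[OF u])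
    next
      case False
      then have "(poly q (\<theta> u))\<^sup>2 \<le> \<epsilon>\<^sup>2"
        using \<epsilon>(2)[OF u] by (metis abs_ge_zero power2_abs power_mono)
      then show ?thesis by (simp add: coord[OF u] power_mult_distrib mult_right_mono)
    qed
    show "(norm (S *v (b - A *v y)))\<^sup>2 \<le> (\<epsilon> * norm (S *v r0))\<^sup>2"
      unfolding power_mult_distrib norm_power2_orthonormal_basis[OF U, simplified] sum_distrib_left
      by (intro sum_mono le)
    show "0 \<le> \<epsilon> * norm (S *v r0)" using \<epsilon>(1) by simp
  qed
  finally show ?thesis unfolding r0_def .
qed

theorem theorem2p9:
  fixes A M N H C :: "real ^ 'n ^ 'n" and l :: nat
  assumes "sym_psd A"
    and "transpose M = M" and "invertible M"
    and "A = M - N"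
    and "H = matrix_inv M ** N"
    and "l \<ge> 1"
    and "C = inner_precond M H l"
    and "sym_pd C"
    and "semiconvergent H"
  shows "\<forall>b \<in> range ((*v) A). \<forall>x0 k xk. minres_iterate C A b x0 k xk \<longrightarrow>
    norm (msqrt C *v (b - A *v xk))
      \<le> min (pseudo_spectral_radius H ^ (k * l))
            (2 * ((sqrt (spectral_cond (C ** A)) - 1) / (sqrt (spectral_cond (C ** A)) + 1)) ^ k)
        * norm (msqrt C *v (b - A *v x0))"
proof (intro ballI allI impI)
  fix b x0 k xk
  assume b: "b \<in> range ((*v) A)" and xk: "minres_iterate C A b x0 k xk"
  define S where "S = msqrt C"
  have A: "transpose A = A" "\<And>x. 0 \<le> x \<bullet> (A *v x)"
    using assms(1) by (auto simp: sym_psd_def)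
  have N: "N = M - A" using assms(4) by simp
  have "transpose N = N"
    using A(1) assms(2) by (simp add: N transpose_def vec_eq_iff)
  have "matrix_inv M ** A = mat 1 - H"
    using matrix_inv_inverse(2)[OF assms(3)] by (simp add: assms(4,5) matrix_diff_ldistrib)
  then have CA: "C ** A = mat 1 - matpow H l"
    unfolding assms(7) by (rule inner_precond_mult)
  have HC: "transpose (H ** C) = H ** C"
    unfolding assms(7)
    by (rule transpose_iteration_inner_precond[OF assms(3,2) \<open>transpose N = N\<close> assms(5)])
  have "sym_psd C"
    using assms(8) unfolding sym_pd_def sym_psd_def by (metis inner_zero_left less_imp_le order_refl)
  then have S: "sym_psd S" "S ** S = C" unfolding S_def by (rule msqrt_sym_psd)+
  have tS: "transpose S = S" using S(1) by (simp add: sym_psd_def)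
  have Sinj: "x = 0" if "S *v x = 0" for x
    using that S(2) assms(8) unfolding sym_pd_def
    by (metis inner_zero_right less_irrefl matrix_vector_mul_assoc matrix_vector_mult_0_right)
  then obtain P where PS: "P ** S = mat 1"
    using matrix_left_invertible_ker[of S] by auto
  then have SP: "S ** P = mat 1" using matrix_left_right_inverse[of P S] by blast
  then have tP: "transpose P = P"
    using tS PS by (metis matrix_mul_assoc matrix_mul_lid matrix_mul_rid matrix_transpose_mul transpose_mat)
  define G where "G = P ** H ** S"
  \<comment> \<open>As \<open>C = S ** S\<close> and \<open>P\<close> inverts \<open>S\<close>, the
    matrix \<open>G\<close> is a congruence transform of the symmetric matrix
    \<open>H ** C\<close>.\<close>
  have "G = P ** (H ** C) ** P"
    unfolding G_def S(2)[symmetric] using SP by (metis matrix_mul_assoc matrix_mul_rid)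
  then have tG: "transpose G = G"
    using HC tP by (simp add: matrix_transpose_mul matrix_mul_assoc[symmetric])
  have HS: "H ** S = S ** G"
    unfolding G_def using SP by (metis matrix_mul_assoc matrix_mul_lid)
  obtain U \<mu> where U: "finite U" "pairwise orthogonal U" "\<And>u. u \<in> U \<Longrightarrow> norm u = 1" "span U = UNIV"
    and eig: "\<And>u. u \<in> U \<Longrightarrow> G *v u = \<mu> u *\<^sub>R u"
    using symmetric_orthonormal_eigenbasis[OF tG] by metis
  have U0: "0 \<notin> U" using U(3) by force
  define \<theta> where "\<theta> u = 1 - \<mu> u ^ l" for u
  have eigA: "(S ** A ** S) *v u = \<theta> u *\<^sub>R u" if u: "u \<in> U" for u
  proof -
    have "H *v (S *v u) = \<mu> u *\<^sub>R (S *v u)"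
      using HS eig[OF u] by (metis matrix_vector_mul_assoc matrix_vector_mult_scaleR)
    then have "matpow H l *v (S *v u) = \<mu> u ^ l *\<^sub>R (S *v u)"
      by (rule matpow_eigenvector)
    then have "(C ** A) *v (S *v u) = \<theta> u *\<^sub>R (S *v u)"
      by (simp add: CA matrix_vector_mult_diff_rdistrib \<theta>_def algebra_simps)
    then have "S *v ((S ** A ** S) *v u - \<theta> u *\<^sub>R u) = 0"
      by (simp add: S(2)[symmetric] matrix_vector_mult_diff_distrib matrix_vector_mult_scaleR
          matrix_vector_mul_assoc matrix_mul_assoc)
    then show ?thesis using Sinj by force
  qed
  have specH: "spectrum H = complex_of_real ` \<mu> ` U"
    by (rule spectrum_symmetrizable[OF PS HS tG U(4) U0 eig])
  have "spectrum (C ** A) = complex_of_real ` \<theta> ` U"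
  proof (rule spectrum_symmetrizable[OF PS _ _ U(4) U0 eigA])
    show "C ** A ** S = S ** (S ** A ** S)" by (simp add: S(2)[symmetric] matrix_mul_assoc)
    show "transpose (S ** A ** S) = S ** A ** S"
      by (simp add: matrix_transpose_mul tS A(1) matrix_mul_assoc)
  qed
  then have ev: "real_eigenvalues (C ** A) = \<theta> ` U"
    unfolding real_eigenvalues_def by auto
  have \<theta>_nonneg: "0 \<le> \<theta> u" if u: "u \<in> U" for u
  proof -
    have "0 \<le> (S *v u) \<bullet> (A *v (S *v u))" by (rule A)
    also have "\<dots> = u \<bullet> ((S ** A ** S) *v u)"
      using tS by (metis dot_lmul_matrix transpose_matrix_vector matrix_vector_mul_assoc matrix_mul_assoc)
    also have "\<dots> = \<theta> u" using U(3)[OF u] by (simp add: eigA[OF u] dot_square_norm)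
    finally show ?thesis .
  qed
  define \<nu> where "\<nu> = pseudo_spectral_radius H"
  have fin: "finite (spectrum H - {1})" using U(1) by (simp add: specH)
  have \<nu>_ge: "cmod z \<le> \<nu>" if "z \<in> spectrum H - {1}" for z
    using that fin unfolding \<nu>_def pseudo_spectral_radius_def by (auto intro!: Max_ge)
  have \<nu>0: "0 \<le> \<nu>"
  proof (cases "spectrum H - {1} = {}")
    case False
    then show ?thesis using \<nu>_ge norm_ge_zero order_trans by blast
  qed (simp add: \<nu>_def pseudo_spectral_radius_def)
  have bound1: "norm (S *v (b - A *v xk)) \<le> \<nu> ^ (k * l) * norm (S *v (b - A *v x0))"
    unfolding S_def
  proof (rule minres_residual_le[OF A(1) assms(8) U eigA[unfolded S_def] b xk])
    show "degree ([:1, - 1:] ^ k :: real poly) \<le> k"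
      using degree_power_le[of "[:1, - 1:] :: real poly" k] by simp
    show "poly ([:1, - 1:] ^ k) (0::real) = 1" by simp
    show "0 \<le> \<nu> ^ (k * l)" using \<nu>0 by simp
    fix u assume u: "u \<in> U" "\<theta> u \<noteq> 0"
    \<comment> \<open>Only eigenvalues with \<open>\<theta> u \<noteq> 0\<close> matter, and these
      come from \<mu> other than 1, which \<nu> controls. On them (1 - X)^k takes the value \<mu>^(l
      k).\<close>
    then have "\<mu> u \<noteq> 1" by (auto simp: \<theta>_def)
    then have "\<bar>\<mu> u\<bar> \<le> \<nu>" using \<nu>_ge[of "complex_of_real (\<mu> u)"] u(1) by (simp add: specH)
    then have "\<bar>\<mu> u\<bar> ^ (k * l) \<le> \<nu> ^ (k * l)" by (simp add: power_mono)
    then show "\<bar>poly ([:1, - 1:] ^ k) (\<theta> u)\<bar> \<le> \<nu> ^ (k * l)"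
      by (simp add: \<theta>_def power_abs power_mult[symmetric] mult.commute)
  qed
  define \<kappa> where "\<kappa> = spectral_cond (C ** A)"
  obtain q where q: "degree q \<le> k" "poly q 0 = 1"
    "\<And>u. u \<in> U \<Longrightarrow> \<theta> u \<noteq> 0 \<Longrightarrow> \<bar>poly q (\<theta> u)\<bar> \<le> 2 * ((sqrt \<kappa> - 1) / (sqrt \<kappa> + 1)) ^ k" and \<kappa>: "1 \<le> \<kappa>"
  proof (cases "\<theta> ` U - {0} = {}")
    case True
    \<comment> \<open>All eigenvalues of \<open>C ** A\<close> vanish, so the conventional value 1
      applies and the bound on \<open>q\<close> is vacuous.\<close>
    then have "\<kappa> = 1" by (simp add: \<kappa>_def spectral_cond_def ev)
    then show thesis using True by (intro that[of 1]) auto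
  next
    case False
    define a where "a = Min (\<theta> ` U - {0})"
    define c where "c = Max (\<theta> ` U)"
    have \<kappa>: "\<kappa> = c / a" using False by (simp add: \<kappa>_def spectral_cond_def ev a_def c_def)
    have range: "a \<le> \<theta> u" "\<theta> u \<le> c" if "u \<in> U" "\<theta> u \<noteq> 0" for u
      using that U(1) unfolding a_def c_def by (auto intro!: Min_le Max_ge)
    have "a \<in> \<theta> ` U - {0}" unfolding a_def using U(1) False by (intro Min_in) auto
    then obtain w where w: "w \<in> U" "a = \<theta> w" "a \<noteq> 0" by auto
    \<comment> \<open>Nonnegativity of all \<open>\<theta> u\<close> makes the smallest nonzero one
      positive, so the nonzero eigenvalues lie in [a, c] with a > 0, as the Chebyshev estimate
      requires.\<close>
    then have a: "0 < a" "a \<le> c" using \<theta>_nonneg[of w] range(2)[of w] by auto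
    show thesis
      using chebyshev_residual_poly[OF a, of k] range a that unfolding \<kappa>
      by (smt (verit, best) le_divide_eq_1_pos)
  qed
  \<comment> \<open>The residual lemma asks for a nonnegative bound, which is why
    \<open>1 \<le> \<kappa>\<close> was obtained along with \<open>q\<close>.\<close>
  have "0 \<le> 2 * ((sqrt \<kappa> - 1) / (sqrt \<kappa> + 1)) ^ k" using \<kappa> by simp
  then have bound2: "norm (S *v (b - A *v xk)) \<le>
      2 * ((sqrt \<kappa> - 1) / (sqrt \<kappa> + 1)) ^ k * norm (S *v (b - A *v x0))"
    unfolding S_def using q
    by (intro minres_residual_le[OF A(1) assms(8) U eigA[unfolded S_def] b xk, of q]) auto
  show "norm (msqrt C *v (b - A *v xk))
      \<le> min (pseudo_spectral_radius H ^ (k * l))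
            (2 * ((sqrt (spectral_cond (C ** A)) - 1) / (sqrt (spectral_cond (C ** A)) + 1)) ^ k)
        * norm (msqrt C *v (b - A *v x0))"
    using bound1 bound2 unfolding S_def \<nu>_def \<kappa>_def by (simp add: min_def)
qed

end
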